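(* Let $A\in\mathbb{R}^{n\times n}$ be stable (all eigenvalues have negative real part), $h_0=B\in\mathbb{R}^{n\times 1}$, let $N,s\ge1$ with $Ns<n$, let $\omega_1,\dots,\omega_N>0$, $\Lambda\in\mathbb{C}^{s\times s}$ and $\beta\in\mathbb{C}^s$ be such that $\omega_j\mu\lambda\ne1$ for all $j=1,\dots,N$, all eigenvalues $\mu$ of $\Lambda$ and all eigenvalues $\lambda$ of $A$. Let $\hat\Lambda\in\mathbb{C}^{Ns\times Ns}$, the Jordan blocks $J_l\in\mathbb{C}^{s_l\times s_l}$ with diagonal entries $\hat\mu_l$ ($l=1,\dots,q$), and the matrices $\hat{\mathcal H}'_l\in\mathbb{C}^{n\times s_l}$ be as defined in the context. Assume that $(\hat\Lambda^{\mathsf T},\mathds{1}_{Ns}^{\mathsf T})$ is observable. Then for every $l=1,\dots,q$: if $\hat\mu_l\neq0$, then $$\operatorname{span}\hat{\mathcal H}'_l=\operatorname{span}\{(I_n-\hat\mu_lA)^{-i}h_0\mid i=1,\dots,s_l\},$$ and if $\hat\mu_l=0$, then $$\operatorname{span}\hat{\mathcal H}'_l=\operatorname{span}\{A^ih_0\mid i=0,\dots,s_l-1\}.$$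
   Context: Notation: $\mathds{1}_m\in\mathbb{R}^m$ is the all-ones column vector; the span of a matrix is the (complex) span of its columns. A pair $(M,c)$ with $M\in\mathbb{C}^{m\times m}$ and $c\in\mathbb{C}^{1\times m}$ is observable if the matrix with rows $c,cM,\dots,cM^{m-1}$ has rank $m$. The matrix $\hat\Lambda\in\mathbb{C}^{Ns\times Ns}$ is defined by specifying its transpose $\hat\Lambda^{\mathsf T}$, which is block upper triangular with $N\times N$ blocks of size $s\times s$: the $(i,i)$ block is $\omega_i\Lambda^{\mathsf T}$, the $(i,j)$ block for $i<j$ is $\omega_i[\beta,\dots,\beta]=\omega_i\beta\mathds{1}_s^{\mathsf T}$, and the $(i,j)$ block for $i>j$ is $0$. The matrix $\hat{\mathcal H}\in\mathbb{C}^{n\times Ns}$ is the unique solution of $$\hat{\mathcal H}=\mathds{1}_{Ns}^{\mathsf T}\otimes h_0+A\hat{\mathcal H}\hat\Lambda^{\mathsf T}.$$ Equivalently, $\hat{\mathcal H}=[\mathcal H_1,\dots,\mathcal H_N]$, where for $j=1,\dots,N$ the matrix $\mathcal H_j\in\mathbb{C}^{n\times s}$ solves $\mathcal H_j=[h_{j-1},\dots,h_{j-1}]+\omega_jA\mathcal H_j\Lambda^{\mathsf T}$ and $h_j=h_{j-1}+\omega_jA\mathcal H_j\beta$. Let $S\in\mathbb{C}^{Ns\times Ns}$ be an invertible matrix transforming $\hat\Lambda^{\mathsf T}$ to Jordan canonical form, $S\hat\Lambda^{\mathsf T}S^{-1}=\operatorname{diag}(J_1,\dots,J_q)$, where $J_l\in\mathbb{C}^{s_l\times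 s_l}$ is an upper Jordan block (ones on the superdiagonal) with eigenvalue $\hat\mu_l$. Define $\hat{\mathcal H}'=\hat{\mathcal H}S^{-1}$ and partition it column-wise as $\hat{\mathcal H}'=[\hat{\mathcal H}'_1,\dots,\hat{\mathcal H}'_q]$ with $\hat{\mathcal H}'_l\in\mathbb{C}^{n\times s_l}$. *)

theory Defs
  imports
    Complex_Main
    "Jordan_Normal_Form.Jordan_Normal_Form"
    "Jordan_Normal_Form.DL_Rank"
begin

abbreviation cmat :: "real mat \<Rightarrow> complex mat" where
  "cmat \<equiv> map_mat complex_of_real"

abbreviation vec_span :: "nat \<Rightarrow> complex vec set \<Rightarrow> complex vec set" where
  "vec_span n \<equiv> LinearCombinations.module.span class_ring (module_vec TYPE(complex) n)"

definition stable_mat :: "real mat \<Rightarrow> bool" where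
  "stable_mat A \<longleftrightarrow> (\<forall>z. eigenvalue (cmat A) z \<longrightarrow> Re z < 0)"

definition kronecker :: "complex mat \<Rightarrow> complex mat \<Rightarrow> complex mat" where
  "kronecker X Y = mat (dim_row X * dim_row Y) (dim_col X * dim_col Y)
     (\<lambda>(i, j). X $$ (i div dim_row Y, j div dim_col Y) * Y $$ (i mod dim_row Y, j mod dim_col Y))"

definition ones_row :: "nat \<Rightarrow> complex mat" where
  "ones_row m = mat 1 m (\<lambda>_. 1)"

definition observability_mat :: "complex mat \<Rightarrow> complex mat \<Rightarrow> complex mat" where
  "observability_mat M c =
     mat_of_rows (dim_row M) (map (\<lambda>i. row (c * M ^\<^sub>m i) 0) [0..<dim_row M])"

definition observable :: "complex mat \<Rightarrow> complex mat \<Rightarrow> bool" where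
  "observable M c \<longleftrightarrow>
     vec_space.rank (dim_row M) (observability_mat M c) = dim_row M"

(* Blocks are numbered from 0 here, so omega i is the parameter of block i + 1 in the usual
   one-based numbering.  Entry (r, k) of the transpose lies in block (r div s, k div s), at
   position (r mod s, k mod s); every column of an off-diagonal block above the diagonal is
   a multiple of beta. *)
definition Lambda_hat ::
  "nat \<Rightarrow> nat \<Rightarrow> (nat \<Rightarrow> real) \<Rightarrow> complex mat \<Rightarrow> complex vec \<Rightarrow> complex mat" where
  "Lambda_hat N s \<omega> \<Lambda> \<beta> = (mat (N * s) (N * s) (\<lambda>(r, k).
     if r div s = k div s then complex_of_real (\<omega> (r div s)) * \<Lambda>\<^sup>T $$ (r mod s, k mod s)
     else if r div s < k div s then complex_of_real (\<omega> (r div s)) * \<beta> $ (r mod s)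
     else 0))\<^sup>T"

(* The equation has exactly one solution whenever no product of an eigenvalue of L and an
   eigenvalue of A equals 1; otherwise the description below may be unspecified. *)
definition H_hat :: "complex mat \<Rightarrow> complex mat \<Rightarrow> complex mat \<Rightarrow> complex mat" where
  "H_hat A h0 L = (THE H. H \<in> carrier_mat (dim_row A) (dim_row L) \<and>
     H = kronecker (ones_row (dim_row L)) h0 + A * H * L\<^sup>T)"

(* The l-th block (from 0) of the column-wise partition of M into blocks of widths ks. *)
definition col_block :: "complex mat \<Rightarrow> nat list \<Rightarrow> nat \<Rightarrow> complex mat" where
  "col_block M ks l =
     mat (dim_row M) (ks ! l) (\<lambda>(i, j). M $$ (i, sum_list (take l ks) + j))"

end

theory Submission
  imports Defs
begin

text \<open>In the coordinates that bring the transpose \<open>M\<close> of the coefficient matrix to its Jordan form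
  \<open>J = S M S\<^sup>-\<^sup>1\<close>, the equation \<open>H = \<one>\<^sup>T \<otimes> h\<^sub>0 + A H M\<close> decouples into one recurrence per Jordan block. If \<open>x\<^sub>j\<close> are the columns
  of the solution that belong to a block with eigenvalue \<open>\<mu>\<close>, if \<open>e\<^sub>j\<close> are the matching entries of
  \<open>\<one>\<^sup>T S\<^sup>-\<^sup>1\<close>, and \<open>R = (I - \<mu> A)\<^sup>-\<^sup>1\<close>, comparing columns gives
  \<open>x\<^sub>0 = e\<^sub>0 R h\<^sub>0\<close> and \<open>x\<^sub>j = e\<^sub>j R h\<^sub>0 + R A x\<^sub>j\<^sub>-\<^sub>1\<close>
  (lemma \<open>sylvester_columns\<close>, applied to the bidiagonal matrix \<open>J\<close>).

  Let \<open>f\<^sub>i = R\<^sup>i\<^sup>+\<^sup>1 h\<^sub>0\<close> if \<open>\<mu> \<noteq> 0\<close> and \<open>f\<^sub>i = A\<^sup>i h\<^sub>0\<close> if \<open>\<mu> = 0\<close>. In both cases \<open>f\<^sub>0 = R h\<^sub>0\<close>, and \<open>T = R A\<close> satisfies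
  \<open>T f\<^sub>i = a f\<^sub>i\<^sub>+\<^sub>1 + b f\<^sub>i\<close> with \<open>a \<noteq> 0\<close>: for \<open>\<mu> \<noteq> 0\<close> because \<open>\<mu> R A = R - I\<close>, for \<open>\<mu> = 0\<close>
  because \<open>T = A\<close>. Hence \<open>x\<^sub>j\<close> equals \<open>a\<^sup>j e\<^sub>0 f\<^sub>j\<close> up to a combination of \<open>f\<^sub>0, \<dots>, f\<^sub>j\<^sub>-\<^sub>1\<close>, and if \<open>e\<^sub>0 \<noteq> 0\<close> this triangular
  change of generators preserves spans (lemma \<open>span_krylov\<close>).

  Two points remain. The number \<open>e\<^sub>0\<close> is the value of the row
  \<open>\<one>\<^sup>T\<close> on an eigenvector of \<open>M\<close>, namely the first column of \<open>S\<^sup>-\<^sup>1\<close> in the block, and observability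
  forbids it to vanish (lemma \<open>observable_eigenvector\<close>). The matrix \<open>I - \<mu> A\<close> is invertible because
  \<open>M\<close> is block triangular, so that \<open>\<mu>\<close> is \<open>\<omega>\<^sub>i\<close> times an eigenvalue of \<open>\<Lambda>\<close> (lemma \<open>eigenvalue_Lambda_hat\<close>) and the
  nonresonance condition applies. The same invertibility makes the column recurrence solvable in
  exactly one way, so the description of the solution as the unique one is meaningful
  (lemma \<open>H_hat_solution\<close>).\<close>

section \<open>Spans of Krylov-type sequences\<close>

lemma smult_mat_mult_vec:
  fixes A :: "'a :: comm_ring_1 mat"
  assumes "A \<in> carrier_mat nr nc" "v \<in> carrier_vec nc"
  shows "(c \<cdot>\<^sub>m A) *\<^sub>v v = c \<cdot>\<^sub>v (A *\<^sub>v v)"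
  using assms by (intro eq_vecI) (auto simp: scalar_prod_def sum_distrib_left mult.assoc)

lemma pow_mat_commute:
  assumes A: "A \<in> carrier_mat n n"
  shows "A * A ^\<^sub>m i = A ^\<^sub>m i * A"
proof (induction i)
  case (Suc i)
  have Ai: "A ^\<^sub>m i \<in> carrier_mat n n" using A by simp
  have "A * (A ^\<^sub>m i * A) = A ^\<^sub>m i * A * A"
    using assoc_mult_mat[OF A Ai A] Suc by simp
  then show ?case by simp
qed (use A in simp)

context vec_space
begin

lemma zero_in_span: "0\<^sub>v n \<in> span W"
  using vectorspace.span_zero[OF vectorspace_axioms, of W] by simp

text \<open>The vectors that \<open>T\<close> sends into a fixed span form a submodule, so it suffices to test generators.\<close>

lemma span_mat_image:
  assumes T: "T \<in> carrier_mat n n" and U: "U \<subseteq> carrier_vec n" and W: "W \<subseteq> carrier_vec n"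
    and gen: "\<And>u. u \<in> U \<Longrightarrow> T *\<^sub>v u \<in> span W" and w: "w \<in> span U"
  shows "T *\<^sub>v w \<in> span W"
proof -
  let ?P = "{v \<in> carrier_vec n. T *\<^sub>v v \<in> span W}"
  have sub: "submodule class_ring ?P V"
  proof (unfold_locales, goal_cases)
    case 1 then show ?case by auto
  next
    case (2 v u)
    then show ?case using span_add1[OF W, of "T *\<^sub>v v" "T *\<^sub>v u"]
      by (auto simp: mult_add_distrib_mat_vec[OF T])
  next
    case 3
    then show ?case using zero_in_span[of W] mult_mat_vec[OF T, of "0\<^sub>v n" 0] T by auto
  next
    case (4 c v)
    then show ?case using smult_in_span[OF W, of "T *\<^sub>v v" c]
      by (auto simp: mult_mat_vec[OF T])
  qed
  have "span U \<subseteq> ?P"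
    by (rule span_is_subset[OF _ sub]) (use U gen in auto)
  with w show ?thesis by auto
qed

text \<open>A triangular change of generators with nonzero diagonal can be solved backwards one vector at a
  time, so the partial spans agree for every length.\<close>

lemma span_triangular:
  fixes f x :: "nat \<Rightarrow> 'a vec"
  assumes f: "\<And>j. f j \<in> carrier_vec n"
    and tri: "\<And>j. j < k \<Longrightarrow>
      \<exists>c w. c \<noteq> 0 \<and> w \<in> span (f ` {..<j}) \<and> x j = c \<cdot>\<^sub>v f j + w"
  shows "span (x ` {..<k}) = span (f ` {..<k})"
  using tri
proof (induction k)
  case (Suc k)
  have fc: "f ` A \<subseteq> carrier_vec n" for A using f by auto
  have IH: "span (x ` {..<k}) = span (f ` {..<k})" using Suc by auto
  obtain c w where c: "c \<noteq> 0" and w: "w \<in> span (f ` {..<k})" and xk: "x k = c \<cdot>\<^sub>v f k + w"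
    using Suc.prems[of k] by auto
  have wc: "w \<in> carrier_vec n" using span_closed[OF fc w] .
  have xc: "x ` {..<Suc k} \<subseteq> carrier_vec n"
  proof
    fix y assume "y \<in> x ` {..<Suc k}"
    then obtain j where j: "j < Suc k" "y = x j" by auto
    from Suc.prems[OF j(1)] obtain c' w'
      where "w' \<in> span (f ` {..<j})" "x j = c' \<cdot>\<^sub>v f j + w'" by auto
    with span_closed[OF fc, of w'] f show "y \<in> carrier_vec n" unfolding j(2) by auto
  qed
  have xkc': "x ` {..<k} \<subseteq> carrier_vec n" using xc by auto
  have fk: "f k \<in> span (f ` {..<Suc k})"
    using span_mem[OF fc] by auto
  have xk': "x k \<in> span (x ` {..<Suc k})"
    using span_mem[OF xc] by auto
  have mono_f: "span (f ` {..<k}) \<subseteq> span (f ` {..<Suc k})"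
    by (rule span_is_monotone) auto
  have mono_x: "span (x ` {..<k}) \<subseteq> span (x ` {..<Suc k})"
    by (rule span_is_monotone) auto
  have "x k \<in> span (f ` {..<Suc k})"
    using span_add1[OF fc smult_in_span[OF fc fk, of c], of w] mono_f w xk by auto
  moreover have "x ` {..<k} \<subseteq> span (f ` {..<Suc k})"
    using span_mem[OF xkc'] IH mono_f by auto
  ultimately have 1: "x ` {..<Suc k} \<subseteq> span (f ` {..<Suc k})"
    by (auto simp: lessThan_Suc)
  have wx: "- 1 \<cdot>\<^sub>v w \<in> span (x ` {..<Suc k})"
    by (rule smult_in_span[OF xc]) (use w IH mono_x in auto)
  have "x k + - 1 \<cdot>\<^sub>v w \<in> span (x ` {..<Suc k})"
    using span_add1[OF xc xk' wx] by simp
  then have "(1 / c) \<cdot>\<^sub>v (x k + - 1 \<cdot>\<^sub>v w) \<in> span (x ` {..<Suc k})"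
    by (rule smult_in_span[OF xc])
  moreover have "(1 / c) \<cdot>\<^sub>v (x k + - 1 \<cdot>\<^sub>v w) = f k"
    unfolding xk using f[of k] wc c by (intro eq_vecI) (auto simp: field_simps)
  ultimately have "f k \<in> span (x ` {..<Suc k})" by simp
  moreover have "f ` {..<k} \<subseteq> span (x ` {..<Suc k})"
    using span_mem[OF fc, of _ "{..<k}"] IH mono_x by auto
  ultimately have 2: "f ` {..<Suc k} \<subseteq> span (x ` {..<Suc k})"
    by (auto simp: lessThan_Suc)
  show ?case
    using span_subsetI[OF fc 1] span_subsetI[OF xc 2] by auto
qed auto

text \<open>The vectors \<open>x\<close> are driven by \<open>f 0\<close> and \<open>T\<close>, and \<open>T\<close> raises the index of \<open>f\<close> by one, up to lower terms. The coefficient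
  of \<open>f j\<close> in \<open>x j\<close> is therefore \<open>a ^ j * e 0\<close>, which is nonzero, and all other contributions have lower
  index, whatever the inputs \<open>e j\<close> with \<open>j > 0\<close> are.\<close>

lemma span_krylov:
  fixes f x :: "nat \<Rightarrow> 'a vec"
  assumes T: "T \<in> carrier_mat n n" and f: "\<And>i. f i \<in> carrier_vec n"
    and Tf: "\<And>i. T *\<^sub>v f i = a \<cdot>\<^sub>v f (Suc i) + b \<cdot>\<^sub>v f i" and a: "a \<noteq> 0"
    and x0: "0 < k \<Longrightarrow> x 0 = e 0 \<cdot>\<^sub>v f 0" and e0: "e 0 \<noteq> 0"
    and xSuc: "\<And>j. Suc j < k \<Longrightarrow> x (Suc j) = e (Suc j) \<cdot>\<^sub>v f 0 + T *\<^sub>v x j"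
  shows "span (x ` {..<k}) = span (f ` {..<k})"
proof (rule span_triangular[OF f])
  have fc: "f ` A \<subseteq> carrier_vec n" for A using f by auto
  have sp: "f i \<in> span (f ` {..<Suc j})" if "i \<le> j" for i j
    using span_mem[OF fc] that by auto
  fix j assume "j < k"
  then show "\<exists>c w. c \<noteq> 0 \<and> w \<in> span (f ` {..<j}) \<and> x j = c \<cdot>\<^sub>v f j + w"
  proof (induction j)
    case 0
    show ?case using x0 0 e0 f[of 0] zero_in_span[of "{}"]
      by (intro exI[of _ "e 0"] exI[of _ "0\<^sub>v n"]) auto
  next
    case (Suc j)
    then obtain c w where c: "c \<noteq> 0" and w: "w \<in> span (f ` {..<j})"
      and xj: "x j = c \<cdot>\<^sub>v f j + w" by auto
    have wc: "w \<in> carrier_vec n" using span_closed[OF fc w] .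
    have Twc: "T *\<^sub>v w \<in> carrier_vec n" using T wc by auto
    have Tw: "T *\<^sub>v w \<in> span (f ` {..<Suc j})"
    proof (rule span_mat_image[OF T fc fc _ w])
      fix u assume "u \<in> f ` {..<j}"
      then obtain i where i: "i < j" "u = f i" by auto
      show "T *\<^sub>v u \<in> span (f ` {..<Suc j})" unfolding i Tf
        using span_add1[OF fc smult_in_span[OF fc sp[of "Suc i" j], of a]
            smult_in_span[OF fc sp[of i j], of b]] i by auto
    qed
    \<comment> \<open>Everything in \<open>x (Suc j)\<close> except the multiple of \<open>f (Suc j)\<close>, which only \<open>T *\<^sub>v f j\<close> produces.\<close>
    let ?w = "e (Suc j) \<cdot>\<^sub>v f 0 + ((c * b) \<cdot>\<^sub>v f j + T *\<^sub>v w)"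
    have "(c * b) \<cdot>\<^sub>v f j + T *\<^sub>v w \<in> span (f ` {..<Suc j})"
      using span_add1[OF fc smult_in_span[OF fc sp[of j j], of "c * b"] Tw] by auto
    from span_add1[OF fc smult_in_span[OF fc sp[of 0 j], of "e (Suc j)"] this]
    have w': "?w \<in> span (f ` {..<Suc j})" by auto
    have "x (Suc j) = e (Suc j) \<cdot>\<^sub>v f 0 + (c \<cdot>\<^sub>v (a \<cdot>\<^sub>v f (Suc j) + b \<cdot>\<^sub>v f j) + T *\<^sub>v w)"
      unfolding xSuc[OF Suc.prems] xj using f[of j] wc
      by (simp add: mult_add_distrib_mat_vec[OF T] mult_mat_vec[OF T] Tf)
    also have "\<dots> = (c * a) \<cdot>\<^sub>v f (Suc j) + ?w"
      using f[of 0] f[of j] f[of "Suc j"] Twc carrier_matD[OF T]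
      by (intro eq_vecI) (auto simp: algebra_simps)
    finally show ?case using c a w' by (intro exI[of _ "c * a"] exI[of _ ?w]) auto
  qed
qed

text \<open>With \<open>R\<close> the inverse of \<open>1 - \<mu> A\<close>, the identity \<open>\<mu> R A = R - 1\<close> shows that \<open>R A\<close> maps \<open>R ^ i b\<close> to
  \<open>(R ^ (i + 1) b - R ^ i b) / \<mu>\<close>, so the powers of \<open>R\<close> are a sequence as in \<open>span_krylov\<close>.\<close>

lemma span_resolvent_chain:
  assumes A: "A \<in> carrier_mat n n" and R: "R \<in> carrier_mat n n"
    and RM: "R * (1\<^sub>m n - \<mu> \<cdot>\<^sub>m A) = 1\<^sub>m n" and \<mu>: "\<mu> \<noteq> 0" and b: "b \<in> carrier_vec n"
    and x0: "0 < k \<Longrightarrow> x 0 = e 0 \<cdot>\<^sub>v (R *\<^sub>v b)" and e0: "e 0 \<noteq> 0"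
    and xSuc: "\<And>j. Suc j < k \<Longrightarrow> x (Suc j) = e (Suc j) \<cdot>\<^sub>v (R *\<^sub>v b) + (R * A) *\<^sub>v x j"
  shows "span (x ` {..<k}) = span ((\<lambda>i. R ^\<^sub>m Suc i *\<^sub>v b) ` {..<k})"
proof -
  let ?f = "\<lambda>i. R ^\<^sub>m Suc i *\<^sub>v b"
  have RA: "R * A \<in> carrier_mat n n" by (rule mult_carrier_mat[OF R A])
  have \<mu>A: "\<mu> \<cdot>\<^sub>m A \<in> carrier_mat n n" using A by simp
  have Rp: "R ^\<^sub>m i \<in> carrier_mat n n" for i using R by simp
  have f: "?f i \<in> carrier_vec n" for i by (rule mult_mat_vec_carrier[OF Rp b])
  have Rf: "R *\<^sub>v ?f i = ?f (Suc i)" for i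
    using assoc_mult_mat_vec[OF R Rp b, of "Suc i"] pow_mat_commute[OF R, of "Suc i"] by simp
  have Tf: "(R * A) *\<^sub>v ?f i = (1 / \<mu>) \<cdot>\<^sub>v ?f (Suc i) + (- 1 / \<mu>) \<cdot>\<^sub>v ?f i" for i
  proof -
    define u where "u = ?f i"
    define u' where "u' = ?f (Suc i)"
    have u: "u \<in> carrier_vec n" "u' \<in> carrier_vec n" unfolding u_def u'_def by (rule f)+
    have Tu: "(R * A) *\<^sub>v u \<in> carrier_vec n" by (rule mult_mat_vec_carrier[OF RA u(1)])
    have Au: "A *\<^sub>v u \<in> carrier_vec n" by (rule mult_mat_vec_carrier[OF A u(1)])
    have "u = (R * (1\<^sub>m n - \<mu> \<cdot>\<^sub>m A)) *\<^sub>v u" unfolding RM using u by simp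
    also have "\<dots> = R *\<^sub>v (u - \<mu> \<cdot>\<^sub>v (A *\<^sub>v u))"
      using assoc_mult_mat_vec[OF R _ u(1), of "1\<^sub>m n - \<mu> \<cdot>\<^sub>m A"]
        minus_carrier_mat[OF \<mu>A] \<mu>A u
      by (simp add: minus_mult_distrib_mat_vec[OF one_carrier_mat \<mu>A] smult_mat_mult_vec[OF A])
    also have "\<dots> = u' - \<mu> \<cdot>\<^sub>v ((R * A) *\<^sub>v u)"
      using Au u Rf[of i, folded u_def u'_def] assoc_mult_mat_vec[OF R A u(1)]
      by (simp add: mult_minus_distrib_mat_vec[OF R] mult_mat_vec[OF R])
    finally have eq: "u = u' - \<mu> \<cdot>\<^sub>v ((R * A) *\<^sub>v u)" .
    have "(R * A) *\<^sub>v u = (1 / \<mu>) \<cdot>\<^sub>v u' + (- 1 / \<mu>) \<cdot>\<^sub>v u"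
    proof (rule eq_vecI)
      fix j assume "j < dim_vec ((1 / \<mu>) \<cdot>\<^sub>v u' + (- 1 / \<mu>) \<cdot>\<^sub>v u)"
      then have j: "j < n" using u by simp
      have "u $ j = u' $ j - \<mu> * ((R * A) *\<^sub>v u) $ j"
        using arg_cong[OF eq, of "\<lambda>v. v $ j"] j carrier_vecD[OF Tu]
        by (simp del: index_mult_mat_vec)
      then show "((R * A) *\<^sub>v u) $ j = ((1 / \<mu>) \<cdot>\<^sub>v u' + (- 1 / \<mu>) \<cdot>\<^sub>v u) $ j"
        using j u \<mu> by (simp add: field_simps del: index_mult_mat_vec)
    qed (use carrier_vecD[OF Tu] u in simp)
    then show ?thesis unfolding u_def u'_def .
  qed
  have R1: "R ^\<^sub>m Suc 0 = R" using R by simp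
  show ?thesis
    by (rule span_krylov[where f = ?f and e = e, OF RA f Tf]) (use \<mu> e0 x0 xSuc R1 in simp_all)
qed

text \<open>The case \<open>\<mu> = 0\<close>, where the resolvent is the identity and \<open>A\<close> itself raises the index.\<close>

lemma span_power_chain:
  assumes A: "A \<in> carrier_mat n n" and b: "b \<in> carrier_vec n"
    and x0: "0 < k \<Longrightarrow> x 0 = e 0 \<cdot>\<^sub>v b" and e0: "e 0 \<noteq> 0"
    and xSuc: "\<And>j. Suc j < k \<Longrightarrow> x (Suc j) = e (Suc j) \<cdot>\<^sub>v b + A *\<^sub>v x j"
  shows "span (x ` {..<k}) = span ((\<lambda>i. A ^\<^sub>m i *\<^sub>v b) ` {..<k})"
proof -
  let ?f = "\<lambda>i. A ^\<^sub>m i *\<^sub>v b"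
  have Ap: "A ^\<^sub>m i \<in> carrier_mat n n" for i using A by simp
  have f: "?f i \<in> carrier_vec n" for i by (rule mult_mat_vec_carrier[OF Ap b])
  have "A *\<^sub>v ?f i = ?f (Suc i)" for i
    using assoc_mult_mat_vec[OF A Ap b, of i] pow_mat_commute[OF A, of i] by simp
  then have Tf: "A *\<^sub>v ?f i = 1 \<cdot>\<^sub>v ?f (Suc i) + 0 \<cdot>\<^sub>v ?f i" for i
    using f[of i] f[of "Suc i"] by simp
  have "?f 0 = b" using A b by simp
  then show ?thesis
    by (intro span_krylov[where f = ?f and e = e, OF A f Tf]) (use e0 x0 xSuc in simp_all)
qed

end

section \<open>Columns of a Jordan matrix\<close>

lemma jordan_matrix_bidiagonal:
  assumes "i < sum_list (map fst bs)" "k < sum_list (map fst bs)" "i \<noteq> k" "Suc i \<noteq> k"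
  shows "jordan_matrix bs $$ (i, k) = 0"
  using assms
proof (induction bs arbitrary: i k)
  case (Cons b bs)
  obtain m a where b: "b = (m, a)" by force
  show ?case
    using Cons.IH[of "i - m" "k - m"] Cons.prems unfolding b jordan_matrix_Cons
    by (auto simp: jordan_block_def)
qed auto

lemma jordan_matrix_diag:
  assumes "l < length bs" "j < fst (bs ! l)"
  shows "sum_list (take l (map fst bs)) + j < sum_list (map fst bs)"
    and "jordan_matrix bs $$ (sum_list (take l (map fst bs)) + j, sum_list (take l (map fst bs)) + j)
      = snd (bs ! l)"
  using assms
proof (induction bs arbitrary: l)
  case (Cons b bs)
  obtain m a where b: "b = (m, a)" by force
  { case 1
    then show ?case using Cons.IH(1)[of "l - 1"] by (cases l) (auto simp: b) }
  { case 2
    then show ?case using Cons.IH[of "l - 1"] unfolding b jordan_matrix_Cons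
      by (cases l) (auto simp: jordan_block_def) }
qed auto

text \<open>The column with index \<open>j = 0\<close> in its block has no superdiagonal entry even when an earlier block
  precedes it; this is what makes the column recurrence restart in each block.\<close>

lemma jordan_matrix_superdiag:
  assumes "l < length bs" "j < fst (bs ! l)" "Suc i = sum_list (take l (map fst bs)) + j"
  shows "jordan_matrix bs $$ (i, Suc i) = (if j = 0 then 0 else 1)"
  using assms
proof (induction bs arbitrary: l i)
  case (Cons b bs)
  obtain m a where b: "b = (m, a)" by force
  show ?case
  proof (cases l)
    case 0
    then show ?thesis using Cons.prems unfolding b jordan_matrix_Cons
      by (auto simp: jordan_block_def)
  next
    case (Suc l')
    have lt: "sum_list (take l' (map fst bs)) + j < sum_list (map fst bs)"
      using jordan_matrix_diag(1)[of l' bs j] Cons.prems Suc by auto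
    show ?thesis
    proof (cases "i < m")
      case True
      \<comment> \<open>Row \<open>i\<close> lies in the first block and column \<open>Suc i\<close> does not, so \<open>Suc i\<close> starts a block: \<open>j = 0\<close>.\<close>
      moreover have "Suc i = m + (sum_list (take l' (map fst bs)) + j)"
        using Cons.prems(3) unfolding Suc b by simp
      ultimately have "sum_list (take l' (map fst bs)) + j = 0" "Suc i = m" by linarith+
      then show ?thesis using lt unfolding b jordan_matrix_Cons by auto
    next
      case False
      then show ?thesis
        using Cons.IH[of l' "i - m"] Cons.prems lt unfolding b jordan_matrix_Cons Suc
        by (auto simp: Suc_diff_le)
    qed
  qed
qed auto

lemma col_mult_bidiagonal:
  fixes X J :: "'a :: comm_semiring_1 mat"
  assumes X: "X \<in> carrier_mat r m" and J: "J \<in> carrier_mat m m" and k: "k < m"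
    and bidiag: "\<And>i. i < m \<Longrightarrow> i \<noteq> k \<Longrightarrow> Suc i \<noteq> k \<Longrightarrow> J $$ (i, k) = 0"
  shows "col (X * J) k = J $$ (k, k) \<cdot>\<^sub>v col X k +
    (if k = 0 then 0\<^sub>v r else J $$ (k - 1, k) \<cdot>\<^sub>v col X (k - 1))"
proof (rule eq_vecI)
  fix i assume "i < dim_vec (J $$ (k, k) \<cdot>\<^sub>v col X k +
    (if k = 0 then 0\<^sub>v r else J $$ (k - 1, k) \<cdot>\<^sub>v col X (k - 1)))"
  then have i: "i < r" using X by (auto split: if_splits)
  let ?S = "insert k (if k = 0 then {} else {k - 1})"
  have zero: "J $$ (j, k) = 0" if "j \<in> {0..<m} - ?S" for j
    using that bidiag[of j] by (cases k) auto
  have "col (X * J) k $ i = (\<Sum>j \<in> {0..<m}. X $$ (i, j) * J $$ (j, k))"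
    using X J k i by (auto simp: scalar_prod_def)
  also have "\<dots> = (\<Sum>j \<in> ?S. X $$ (i, j) * J $$ (j, k))"
    by (rule sum.mono_neutral_right) (use k zero in auto)
  finally show "col (X * J) k $ i = (J $$ (k, k) \<cdot>\<^sub>v col X k +
    (if k = 0 then 0\<^sub>v r else J $$ (k - 1, k) \<cdot>\<^sub>v col X (k - 1))) $ i"
    using X J k i by (auto simp: ac_simps)
qed (use assms in auto)

section \<open>The matrix equation X = C + A X J\<close>

lemma mat_inverse_det:
  fixes M :: "'a :: field mat"
  assumes M: "M \<in> carrier_mat n n" and det: "det M \<noteq> 0"
  shows "the (mat_inverse M) \<in> carrier_mat n n"
    and "the (mat_inverse M) * M = 1\<^sub>m n"
proof -
  obtain R where "mat_inverse M = Some R"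
    using mat_inverse(1)[OF M, of "()"] det_non_zero_imp_unit[OF M det, of "()"] by fastforce
  then show "the (mat_inverse M) \<in> carrier_mat n n" "the (mat_inverse M) * M = 1\<^sub>m n"
    using mat_inverse(2)[OF M] by auto
qed

text \<open>Column \<open>k\<close> of \<open>X J\<close> involves only the columns \<open>k\<close> and \<open>k - 1\<close> of \<open>X\<close>. Collecting the terms with column \<open>k\<close>
  on the left gives a linear system with matrix \<open>1 - J\<^sub>k\<^sub>k A\<close>, which turns the matrix equation into a
  one-step recurrence for the columns.\<close>

lemma sylvester_columns:
  fixes A C J X :: "'a :: field mat"
  assumes A: "A \<in> carrier_mat n n" and C: "C \<in> carrier_mat n m" and J: "J \<in> carrier_mat m m"
    and X: "X \<in> carrier_mat n m"
    and bidiag: "\<And>i k. i < m \<Longrightarrow> k < m \<Longrightarrow> i \<noteq> k \<Longrightarrow> Suc i \<noteq> k \<Longrightarrow> J $$ (i, k) = 0"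
    and det: "\<And>k. k < m \<Longrightarrow> det (1\<^sub>m n - J $$ (k, k) \<cdot>\<^sub>m A) \<noteq> 0"
  shows "X = C + A * X * J \<longleftrightarrow> (\<forall>k<m. col X k = the (mat_inverse (1\<^sub>m n - J $$ (k, k) \<cdot>\<^sub>m A)) *\<^sub>v
    (col C k + A *\<^sub>v (if k = 0 then 0\<^sub>v n else J $$ (k - 1, k) \<cdot>\<^sub>v col X (k - 1))))"
    (is "_ \<longleftrightarrow> (\<forall>k<m. col X k = ?R k *\<^sub>v ?y k)")
proof -
  have cols: "X = C + A * X * J \<longleftrightarrow> (\<forall>k<m. col X k = col (C + A * X * J) k)"
  proof
    assume "X = C + A * X * J"
    then show "\<forall>k<m. col X k = col (C + A * X * J) k"
      by (intro allI impI arg_cong[where f = "\<lambda>Z. col Z _"])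
  next
    assume "\<forall>k<m. col X k = col (C + A * X * J) k"
    then show "X = C + A * X * J" using A C J X by (intro mat_col_eqI) auto
  qed
  have "col X k = col (C + A * X * J) k \<longleftrightarrow> col X k = ?R k *\<^sub>v ?y k" if k: "k < m" for k
  proof -
    let ?d = "J $$ (k, k)" and ?x = "col X k"
    let ?p = "if k = 0 then 0\<^sub>v n else J $$ (k - 1, k) \<cdot>\<^sub>v col X (k - 1)"
    let ?M = "1\<^sub>m n - ?d \<cdot>\<^sub>m A"
    have M: "?M \<in> carrier_mat n n" using A by auto
    note R = mat_inverse_det[OF M det[OF k]]
    have MR: "?M * ?R k = 1\<^sub>m n" by (rule mat_mult_left_right_inverse[OF R(1) M R(2)])
    have xc: "?x \<in> carrier_vec n" and cc: "col C k \<in> carrier_vec n" and pc: "?p \<in> carrier_vec n"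
      using X C k by auto
    have yc: "?y k \<in> carrier_vec n" using A cc pc by auto
    have Axc: "A *\<^sub>v ?x \<in> carrier_vec n" "A *\<^sub>v ?p \<in> carrier_vec n" using A xc pc by auto
    have "col (C + A * X * J) k = col C k + A *\<^sub>v col (X * J) k"
      using A C J X k by (simp add: assoc_mult_mat[OF A X J] col_mult2[OF A _ k])
    also have "\<dots> = col C k + (?d \<cdot>\<^sub>v (A *\<^sub>v ?x) + A *\<^sub>v ?p)"
      unfolding col_mult_bidiagonal[OF X J k bidiag[OF _ k], simplified]
      using xc pc by (simp add: mult_add_distrib_mat_vec[OF A] mult_mat_vec[OF A])
    finally have rhs: "col (C + A * X * J) k = col C k + (?d \<cdot>\<^sub>v (A *\<^sub>v ?x) + A *\<^sub>v ?p)" .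
    have Mx: "?M *\<^sub>v ?x = ?x - ?d \<cdot>\<^sub>v (A *\<^sub>v ?x)"
      using A xc by (simp add: minus_mult_distrib_mat_vec[of _ n n] smult_mat_mult_vec[OF A])
    have "?x = col (C + A * X * J) k \<longleftrightarrow> ?M *\<^sub>v ?x = ?y k"
      unfolding rhs Mx using xc cc pc Axc carrier_matD[OF A] carrier_matD[OF X]
      by (auto simp: vec_eq_iff algebra_simps)
    also have "\<dots> \<longleftrightarrow> ?x = ?R k *\<^sub>v ?y k"
    proof
      assume "?M *\<^sub>v ?x = ?y k"
      then have "?R k *\<^sub>v ?y k = (?R k * ?M) *\<^sub>v ?x"
        using assoc_mult_mat_vec[OF R(1) M xc] by simp
      then show "?x = ?R k *\<^sub>v ?y k" using R(2) xc by simp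
    next
      assume "?x = ?R k *\<^sub>v ?y k"
      then have "?M *\<^sub>v ?x = (?M * ?R k) *\<^sub>v ?y k"
        using assoc_mult_mat_vec[OF M R(1) yc] by simp
      then show "?M *\<^sub>v ?x = ?y k" using MR yc by simp
    qed
    finally show ?thesis .
  qed
  then show ?thesis unfolding cols by blast
qed

text \<open>The column recurrence determines the columns from left to right.\<close>

lemma sylvester_ex1:
  fixes A C J :: "'a :: field mat"
  assumes A: "A \<in> carrier_mat n n" and C: "C \<in> carrier_mat n m" and J: "J \<in> carrier_mat m m"
    and bidiag: "\<And>i k. i < m \<Longrightarrow> k < m \<Longrightarrow> i \<noteq> k \<Longrightarrow> Suc i \<noteq> k \<Longrightarrow> J $$ (i, k) = 0"
    and det: "\<And>k. k < m \<Longrightarrow> det (1\<^sub>m n - J $$ (k, k) \<cdot>\<^sub>m A) \<noteq> 0"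
  shows "\<exists>!X. X \<in> carrier_mat n m \<and> X = C + A * X * J"
proof -
  define R where "R k = the (mat_inverse (1\<^sub>m n - J $$ (k, k) \<cdot>\<^sub>m A))" for k
  have R: "R k \<in> carrier_mat n n" if "k < m" for k
    unfolding R_def by (rule mat_inverse_det(1)[OF _ det[OF that]]) (use A in auto)
  define next_col where "next_col k p = R k *\<^sub>v (col C k + A *\<^sub>v p)" for k p
  note columns = sylvester_columns[OF A C J _ bidiag det, folded R_def next_col_def]
  define g where
    "g = rec_nat (next_col 0 (0\<^sub>v n)) (\<lambda>k y. next_col (Suc k) (J $$ (k, Suc k) \<cdot>\<^sub>v y))"
  have g: "g k = next_col k (if k = 0 then 0\<^sub>v n else J $$ (k - 1, k) \<cdot>\<^sub>v g (k - 1))" for k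
    by (cases k) (auto simp: g_def)
  have gc: "g k \<in> carrier_vec n" if "k < m" for k
    unfolding g[of k] next_col_def carrier_vec_def using carrier_matD[OF R[OF that]] by simp
  define X where "X = mat n m (\<lambda>(i, k). g k $ i)"
  have X: "X \<in> carrier_mat n m" unfolding X_def by auto
  have colX: "col X k = g k" if "k < m" for k
    using gc[OF that] that by (auto simp: X_def)
  show ?thesis
  proof (rule ex1I[of _ X])
    have "col X k = next_col k (if k = 0 then 0\<^sub>v n else J $$ (k - 1, k) \<cdot>\<^sub>v col X (k - 1))"
      if "k < m" for k
      using g[of k] colX[of k] colX[of "k - 1"] that by auto
    then have "X = C + A * X * J" by (intro iffD2[OF columns[OF X]]) simp_all
    with X show "X \<in> carrier_mat n m \<and> X = C + A * X * J" by (rule conjI)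
  next
    fix Y assume sol: "Y \<in> carrier_mat n m \<and> Y = C + A * Y * J"
    note Y = conjunct1[OF sol]
    have colY: "col Y k = next_col k (if k = 0 then 0\<^sub>v n else J $$ (k - 1, k) \<cdot>\<^sub>v col Y (k - 1))"
      if "k < m" for k
      using iffD1[OF columns[OF Y] conjunct2[OF sol]] that by simp
    have "col Y k = g k" if "k < m" for k
      using that
    proof (induction k)
      case 0
      then show ?case using colY[of 0] g[of 0] by simp
    next
      case (Suc k)
      then show ?case using colY[of "Suc k"] g[of "Suc k"] by simp
    qed
    then show "Y = X" using X Y colX by (intro mat_col_eqI) auto
  qed
qed

text \<open>A similarity of the right coefficient acts on the unknown by right multiplication with \<open>Q\<close>.\<close>

lemma sylvester_similar:
  fixes A K H J M P Q :: "'a :: field mat"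
  assumes A: "A \<in> carrier_mat n n" and K: "K \<in> carrier_mat n m" and H: "H \<in> carrier_mat n m"
    and J: "J \<in> carrier_mat m m" and sim: "similar_mat_wit J M P Q"
  shows "H = K + A * H * M \<longleftrightarrow> H * Q = K * Q + A * (H * Q) * J"
proof -
  note w = similar_mat_witD2[OF J sim]
  note M = w(5) and P = w(6) and Q = w(7)
  have QJ: "Q * J = M * Q"
  proof -
    have "Q * J = Q * (P * (M * Q))" using w(3) assoc_mult_mat[OF P M Q] by simp
    also have "\<dots> = (Q * P) * (M * Q)" using assoc_mult_mat[OF Q P, of "M * Q" m] M Q by simp
    finally show ?thesis using w(2) M Q by simp
  qed
  have AH: "A * H \<in> carrier_mat n m" using A H by auto
  have AHM: "A * H * M \<in> carrier_mat n m" using AH M by auto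
  have "K * Q + A * (H * Q) * J = K * Q + A * H * (Q * J)"
    using assoc_mult_mat[OF A H Q] assoc_mult_mat[OF AH Q J] by simp
  also have "\<dots> = (K + A * H * M) * Q"
    unfolding QJ add_mult_distrib_mat[OF K AHM Q] using assoc_mult_mat[OF AH M Q] by simp
  finally have eq: "K * Q + A * (H * Q) * J = (K + A * H * M) * Q" .
  have cancel: "X * Q = Y * Q \<longleftrightarrow> X = Y" if X: "X \<in> carrier_mat n m" and Y: "Y \<in> carrier_mat n m" for X Y
  proof
    assume "X * Q = Y * Q"
    then have "X * Q * P = Y * Q * P" by simp
    then show "X = Y"
      using assoc_mult_mat[OF X Q P] assoc_mult_mat[OF Y Q P] w(2) X Y by simp
  qed simp
  show ?thesis unfolding eq by (rule cancel[symmetric]) (use H K AHM in auto)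
qed

lemma sylvester_similar_ex1:
  fixes A K J M P Q :: "'a :: field mat"
  assumes A: "A \<in> carrier_mat n n" and K: "K \<in> carrier_mat n m"
    and J: "J \<in> carrier_mat m m" and sim: "similar_mat_wit J M P Q"
    and ex1: "\<exists>!X. X \<in> carrier_mat n m \<and> X = K * Q + A * X * J"
  shows "\<exists>!H. H \<in> carrier_mat n m \<and> H = K + A * H * M"
proof -
  note w = similar_mat_witD2[OF J sim]
  note P = w(6) and Q = w(7)
  note eqv = sylvester_similar[OF A K _ J sim]
  obtain X where X: "X \<in> carrier_mat n m" and eqX: "X = K * Q + A * X * J"
    and uniq: "\<And>Y. Y \<in> carrier_mat n m \<Longrightarrow> Y = K * Q + A * Y * J \<Longrightarrow> Y = X"
    using ex1 by blast
  show ?thesis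
  proof (rule ex1I[of _ "X * P"])
    have XP: "X * P \<in> carrier_mat n m" using X P by auto
    have "X * P * Q = X" using assoc_mult_mat[OF X P Q] w(1) X by simp
    then show "X * P \<in> carrier_mat n m \<and> X * P = K + A * (X * P) * M"
      using XP eqv[OF XP] eqX by simp
  next
    fix H assume sol: "H \<in> carrier_mat n m \<and> H = K + A * H * M"
    note H = conjunct1[OF sol]
    have "H * Q = X"
      by (rule uniq[OF _ iffD1[OF eqv[OF H] conjunct2[OF sol]]]) (use H Q in simp)
    then show "H = X * P" using assoc_mult_mat[OF H Q P] w(2) H by simp
  qed
qed

section \<open>Eigenvalues and observability\<close>

lemma eigenvalue_diag_upper_triangular:
  fixes J :: "'a :: field mat"
  assumes J: "J \<in> carrier_mat m m" and ut: "upper_triangular J" and k: "k < m"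
  shows "eigenvalue J (J $$ (k, k))"
proof -
  have "J $$ (k, k) \<in> set (diag_mat J)" using J k by (auto simp: diag_mat_def)
  then show ?thesis
    unfolding eigenvalue_root_char_poly[OF J] char_poly_upper_triangular[OF J ut]
    by (auto simp: poly_prod_list prod_list_zero_iff o_def)
qed

lemma eigenvalue_similar:
  fixes J M :: "'a :: field mat"
  assumes J: "J \<in> carrier_mat m m" and sim: "similar_mat_wit J M P Q" and ev: "eigenvalue J z"
  shows "eigenvalue M z"
proof -
  have "M \<in> carrier_mat m m" using similar_mat_witD2[OF J sim] by auto
  moreover have "similar_mat J M"
    unfolding similar_mat_def by (intro exI) (rule sim)
  then have "char_poly J = char_poly M" by (rule char_poly_similar)
  ultimately show ?thesis using ev J by (simp add: eigenvalue_root_char_poly)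
qed

text \<open>A kernel vector of \<open>1 - \<nu> A\<close> is an eigenvector of \<open>A\<close> with eigenvalue \<open>1 / \<nu>\<close>.\<close>

lemma det_one_minus_smult:
  fixes A :: "'a :: field mat"
  assumes A: "A \<in> carrier_mat n n" and nr: "\<And>z. eigenvalue A z \<Longrightarrow> \<nu> * z \<noteq> 1"
  shows "det (1\<^sub>m n - \<nu> \<cdot>\<^sub>m A) \<noteq> 0"
proof
  assume 0: "det (1\<^sub>m n - \<nu> \<cdot>\<^sub>m A) = 0"
  have "1\<^sub>m n - \<nu> \<cdot>\<^sub>m A \<in> carrier_mat n n" using A by auto
  from iffD1[OF det_0_iff_vec_prod_zero_field[OF this] 0] obtain v where v: "v \<in> carrier_vec n" "v \<noteq> 0\<^sub>v n" "(1\<^sub>m n - \<nu> \<cdot>\<^sub>m A) *\<^sub>v v = 0\<^sub>v n"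
    by blast
  have Av: "A *\<^sub>v v \<in> carrier_vec n" using A v by auto
  have diff0: "v - \<nu> \<cdot>\<^sub>v (A *\<^sub>v v) = 0\<^sub>v n"
    using v A by (simp add: minus_mult_distrib_mat_vec[of _ n n] smult_mat_mult_vec[OF A])
  have eq: "v = \<nu> \<cdot>\<^sub>v (A *\<^sub>v v)"
  proof (rule eq_vecI)
    fix i assume "i < dim_vec (\<nu> \<cdot>\<^sub>v (A *\<^sub>v v))"
    then have i: "i < n" using carrier_matD[OF A] by simp
    have "(v - \<nu> \<cdot>\<^sub>v (A *\<^sub>v v)) $ i = 0\<^sub>v n $ i" by (simp only: diff0)
    then show "v $ i = (\<nu> \<cdot>\<^sub>v (A *\<^sub>v v)) $ i"
      using i carrier_vecD[OF v(1)] carrier_vecD[OF Av] by simp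
  qed (use carrier_vecD[OF v(1)] carrier_vecD[OF Av] in simp)
  have \<nu>: "\<nu> \<noteq> 0"
  proof
    assume "\<nu> = 0"
    then have "\<nu> \<cdot>\<^sub>v (A *\<^sub>v v) = 0\<^sub>v n"
      using carrier_matD[OF A] by (intro eq_vecI) simp_all
    with eq have "v = 0\<^sub>v n" by (rule trans)
    with v(2) show False by simp
  qed
  have "A *\<^sub>v v = (1 / \<nu>) \<cdot>\<^sub>v (\<nu> \<cdot>\<^sub>v (A *\<^sub>v v))"
    using \<nu> Av by (simp add: smult_smult_assoc)
  then have "A *\<^sub>v v = (1 / \<nu>) \<cdot>\<^sub>v v" unfolding eq[symmetric] .
  then have "eigenvalue A (1 / \<nu>)"
    unfolding eigenvalue_def eigenvector_def
    by (intro exI[of _ v] conjI) (use v(1,2) A in simp_all)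
  from nr[OF this] \<nu> show False by simp
qed

text \<open>The transposed matrix is block upper triangular with diagonal blocks \<open>\<omega>\<^sub>i \<Lambda>\<^sup>T\<close>. For an eigenvector \<open>v\<close>, let
  \<open>i\<close> be the last block on which \<open>v\<close> does not vanish. In the rows of block \<open>i\<close> the eigenvector equation
  involves only the diagonal block: the blocks to its left are zero, and \<open>v\<close> vanishes on those to its
  right. So the part of \<open>v\<close> in block \<open>i\<close> is an eigenvector of \<open>\<omega>\<^sub>i \<Lambda>\<^sup>T\<close>.\<close>

lemma eigenvalue_Lambda_hat:
  assumes \<Lambda>: "\<Lambda> \<in> carrier_mat s s" and \<omega>: "\<And>i. i < N \<Longrightarrow> \<omega> i \<noteq> 0"
    and ev: "eigenvalue ((Lambda_hat N s \<omega> \<Lambda> \<beta>)\<^sup>T) z"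
  obtains i \<mu> where "i < N" "eigenvalue \<Lambda> \<mu>" "z = complex_of_real (\<omega> i) * \<mu>"
proof -
  let ?M = "(Lambda_hat N s \<omega> \<Lambda> \<beta>)\<^sup>T"
  have M: "?M \<in> carrier_mat (N * s) (N * s)" by (simp add: Lambda_hat_def)
  have entry: "?M $$ (r, k) = (if r div s = k div s
      then complex_of_real (\<omega> (r div s)) * \<Lambda>\<^sup>T $$ (r mod s, k mod s)
     else if r div s < k div s then complex_of_real (\<omega> (r div s)) * \<beta> $ (r mod s)
     else 0)" if "r < N * s" "k < N * s" for r k
    using that by (simp add: Lambda_hat_def)
  obtain v where v: "v \<in> carrier_vec (N * s)" "v \<noteq> 0\<^sub>v (N * s)" "?M *\<^sub>v v = z \<cdot>\<^sub>v v"
    using ev M unfolding eigenvalue_def eigenvector_def by auto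
  let ?I = "{k div s | k. k < N * s \<and> v $ k \<noteq> 0}"
  have fin: "finite ?I" by auto
  have "?I \<noteq> {}" using v(1,2) by (auto simp: vec_eq_iff)
  note max = Max_in[OF fin this] Max_ge[OF fin]
  define i where "i = Max ?I"
  obtain k0 where k0: "k0 < N * s" "v $ k0 \<noteq> 0" "k0 div s = i" using max(1) i_def by auto
  have above: "v $ k = 0" if "k < N * s" "i < k div s" for k
    using max(2)[of "k div s"] that unfolding i_def by fastforce
  have s: "0 < s" using k0(1) by (cases s) auto
  have iN: "i < N" using k0 by (auto simp: less_mult_imp_div_less)
  have idx: "i * s + r < N * s" if "r < s" for r
  proof -
    have "i * s + r < Suc i * s" using that by simp
    also have "\<dots> \<le> N * s" using iN by (intro mult_le_mono1) simp
    finally show ?thesis .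
  qed
  let ?w = "complex_of_real (\<omega> i)"
  define u where "u = vec s (\<lambda>r. v $ (i * s + r))"
  have "u $ (k0 mod s) \<noteq> 0"
    using k0 s by (simp add: u_def flip: k0(3))
  then have u0: "u \<noteq> 0\<^sub>v s" using s by auto
  have "\<Lambda>\<^sup>T *\<^sub>v u = (z / ?w) \<cdot>\<^sub>v u"
  proof (rule eq_vecI)
    fix r assume "r < dim_vec ((z / ?w) \<cdot>\<^sub>v u)"
    then have r: "r < s" by (simp add: u_def)
    have "z * v $ (i * s + r) = (?M *\<^sub>v v) $ (i * s + r)"
      using v(1) idx[OF r] by (simp add: v(3))
    also have "\<dots> = (\<Sum>k \<in> {0..<N * s}. ?M $$ (i * s + r, k) * v $ k)"
      using v(1) M idx[OF r] by (auto simp: scalar_prod_def)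
    also have "\<dots> = (\<Sum>k \<in> {i * s..<i * s + s}. ?M $$ (i * s + r, k) * v $ k)"
    proof (rule sum.mono_neutral_right)
      show "{i * s..<i * s + s} \<subseteq> {0..<N * s}"
      proof
        fix k assume "k \<in> {i * s..<i * s + s}"
        then show "k \<in> {0..<N * s}" using idx[of "k - i * s"] by auto
      qed
      show "\<forall>k \<in> {0..<N * s} - {i * s..<i * s + s}. ?M $$ (i * s + r, k) * v $ k = 0"
      proof
        fix k assume k: "k \<in> {0..<N * s} - {i * s..<i * s + s}"
        have "k div s \<noteq> i"
        proof
          assume "k div s = i"
          then have "k = i * s + k mod s" by (metis div_mult_mod_eq)
          then show False using k mod_less_divisor[OF s, of k] by auto
        qed
        then consider "k div s < i" | "i < k div s" by linarith
        then show "?M $$ (i * s + r, k) * v $ k = 0"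
        proof cases
          case 1
          then show ?thesis using k r entry[OF idx[OF r], of k] by simp
        next
          case 2
          then show ?thesis using k above[of k] by simp
        qed
      qed
    qed simp
    also have "\<dots> = (\<Sum>k \<in> {0..<s}. ?M $$ (i * s + r, i * s + k) * v $ (i * s + k))"
      using sum.shift_bounds_nat_ivl[of "\<lambda>k. ?M $$ (i * s + r, k) * v $ k" 0 "i * s" s]
      by (simp add: add.commute)
    also have "\<dots> = (\<Sum>k \<in> {0..<s}. ?w * (\<Lambda>\<^sup>T $$ (r, k) * u $ k))"
      by (rule sum.cong) (use r entry[OF idx[OF r] idx] in \<open>auto simp: u_def\<close>)
    also have "\<dots> = ?w * (\<Lambda>\<^sup>T *\<^sub>v u) $ r"
      using \<Lambda> r by (simp add: scalar_prod_def sum_distrib_left u_def)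
    finally show "(\<Lambda>\<^sup>T *\<^sub>v u) $ r = ((z / ?w) \<cdot>\<^sub>v u) $ r"
      using \<omega>[OF iN] r by (simp add: u_def field_simps)
  qed (use \<Lambda> in \<open>simp add: u_def\<close>)
  then have "eigenvalue (\<Lambda>\<^sup>T) (z / ?w)"
    unfolding eigenvalue_def eigenvector_def using u0 \<Lambda> by (intro exI[of _ u]) (auto simp: u_def)
  then have "eigenvalue \<Lambda> (z / ?w)"
    using \<Lambda> by (simp add: eigenvalue_root_char_poly[of _ s])
  with that[OF iN this] \<omega>[OF iN] show thesis by simp
qed

text \<open>If \<open>c v = 0\<close> for an eigenvector \<open>v\<close> of \<open>M\<close>, then \<open>c M\<^sup>i v = z\<^sup>i c v = 0\<close> for all \<open>i\<close>, so \<open>v\<close> lies in the kernel of the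
  observability matrix, which is square and thus has deficient rank.\<close>

lemma observable_eigenvector:
  assumes M: "M \<in> carrier_mat m m" and c: "c \<in> carrier_mat 1 m" and obs: "observable M c"
    and v: "eigenvector M v z"
  shows "row c 0 \<bullet> v \<noteq> 0"
proof
  assume cv: "row c 0 \<bullet> v = 0"
  have vc: "v \<in> carrier_vec m" and v0: "v \<noteq> 0\<^sub>v m"
    using v unfolding eigenvector_def carrier_matD(1)[OF M] by simp_all
  let ?O = "observability_mat M c"
  have O: "?O \<in> carrier_mat m m" using M by (auto simp: observability_mat_def)
  have "?O *\<^sub>v v = 0\<^sub>v m"
  proof (rule eq_vecI)
    fix i assume "i < dim_vec (0\<^sub>v m :: complex vec)"
    then have i: "i < m" by simp
    have Mi: "M ^\<^sub>m i \<in> carrier_mat m m" using M by simp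
    have cM: "c * M ^\<^sub>m i \<in> carrier_mat 1 m" by (rule mult_carrier_mat[OF c Mi])
    have "row ?O i = row (c * M ^\<^sub>m i) 0"
      unfolding observability_mat_def
      unfolding carrier_matD(1)[OF M]
      using mat_of_rows_row[of i "map (\<lambda>i. row (c * M ^\<^sub>m i) 0) [0..<m]" m] i row_carrier_vec[OF _ cM, of 0]
      by simp
    moreover have "(?O *\<^sub>v v) $ i = row ?O i \<bullet> v"
      by (rule index_mult_mat_vec) (simp add: carrier_matD[OF O] i)
    ultimately have "(?O *\<^sub>v v) $ i = row (c * M ^\<^sub>m i) 0 \<bullet> v" by simp
    also have "\<dots> = ((c * M ^\<^sub>m i) *\<^sub>v v) $ 0"
      by (rule index_mult_mat_vec[symmetric]) (simp add: carrier_matD[OF c])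
    also have "\<dots> = (c *\<^sub>v (z ^ i \<cdot>\<^sub>v v)) $ 0"
      unfolding assoc_mult_mat_vec[OF c Mi vc] eigenvector_pow[OF M v] ..
    also have "\<dots> = z ^ i * (row c 0 \<bullet> v)"
      unfolding mult_mat_vec[OF c vc] using carrier_matD[OF c] by simp
    also have "\<dots> = 0" unfolding cv by simp
    finally show "(?O *\<^sub>v v) $ i = 0\<^sub>v m $ i" using i by simp
  qed (simp add: carrier_matD[OF O])
  then have "det ?O = 0"
    by (intro iffD2[OF det_0_iff_vec_prod_zero_field[OF O]] exI[of _ v] conjI vc v0)
  then have "vec_space.rank m ?O < m" by (rule vec_space.det_zero_low_rank[OF O])
  then show False using obs unfolding observable_def carrier_matD(1)[OF M] by simp
qed

section \<open>The solution in Jordan coordinates\<close>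

lemma kronecker_ones_row:
  assumes "h \<in> carrier_mat n 1"
  shows "kronecker (ones_row m) h = mat n m (\<lambda>(i, _). h $$ (i, 0))"
  using assms by (intro eq_matI) (auto simp: kronecker_def ones_row_def)

lemma col_col_block:
  assumes "j < ks ! l" "sum_list (take l ks) + j < dim_col M"
  shows "col (col_block M ks l) j = col M (sum_list (take l ks) + j)"
  using assms by (intro eq_vecI) (auto simp: col_block_def)

text \<open>Invertibility of all \<open>1 - J\<^sub>k\<^sub>k A\<close> gives existence and uniqueness, which is what the definite
  description in the definition of \<open>H_hat\<close> needs to denote a solution.\<close>

lemma H_hat_solution:
  assumes A: "A \<in> carrier_mat n n" and h0: "h0 \<in> carrier_mat n 1" and L: "L \<in> carrier_mat m m"
    and sim: "similar_mat_wit (jordan_matrix bs) (L\<^sup>T) P Q"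
    and det: "\<And>k. k < m \<Longrightarrow> det (1\<^sub>m n - jordan_matrix bs $$ (k, k) \<cdot>\<^sub>m A) \<noteq> 0"
  defines "K \<equiv> kronecker (ones_row m) h0" and "H \<equiv> H_hat A h0 L"
  shows "H \<in> carrier_mat n m" and "H * Q = K * Q + A * (H * Q) * jordan_matrix bs"
proof -
  let ?J = "jordan_matrix bs"
  have m: "m = sum_list (map fst bs)"
    using carrier_matD[OF similar_mat_witD(5)[OF refl sim]] carrier_matD[OF L] by simp
  have J: "?J \<in> carrier_mat m m" unfolding m by simp
  have Q: "Q \<in> carrier_mat m m" by (rule similar_mat_witD2(7)[OF J sim])
  have bidiag: "?J $$ (i, k) = 0" if "i < m" "k < m" "i \<noteq> k" "Suc i \<noteq> k" for i k
    by (rule jordan_matrix_bidiagonal) (use that m in simp_all)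
  have K: "K \<in> carrier_mat n m" unfolding K_def kronecker_ones_row[OF h0] by simp
  have KQ: "K * Q \<in> carrier_mat n m" using K Q by auto
  have "\<exists>!X. X \<in> carrier_mat n m \<and> X = K * Q + A * X * ?J"
    by (rule sylvester_ex1[OF A KQ J]) (rule bidiag det; assumption)+
  from sylvester_similar_ex1[OF A K J sim this]
  have ex1: "\<exists>!H. H \<in> carrier_mat n m \<and> H = K + A * H * L\<^sup>T" .
  have "H = (THE H. H \<in> carrier_mat n m \<and> H = K + A * H * L\<^sup>T)"
    unfolding H_def H_hat_def K_def carrier_matD(1)[OF A] carrier_matD(1)[OF L] ..
  note sol = theI'[OF ex1, folded this]
  show H: "H \<in> carrier_mat n m" by (rule conjunct1[OF sol])
  show "H * Q = K * Q + A * (H * Q) * ?J"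
    by (rule iffD1[OF sylvester_similar[OF A K H J sim] conjunct2[OF sol]])
qed

theorem lemma2p2:
  fixes A B :: "real mat" and \<Lambda> S Sinv :: "complex mat" and \<beta> :: "complex vec"
    and \<omega> :: "nat \<Rightarrow> real" and n N s :: nat and blocks :: "(nat \<times> complex) list"
  assumes A: "A \<in> carrier_mat n n" and stable: "stable_mat A"
    and B: "B \<in> carrier_mat n 1"
    and N: "N \<ge> 1" and s: "s \<ge> 1" and Ns: "N * s < n"
    and omega: "\<And>j. j < N \<Longrightarrow> \<omega> j > 0"
    and Lambda: "\<Lambda> \<in> carrier_mat s s" and beta: "\<beta> \<in> carrier_vec s"
    and nonres: "\<And>j \<mu> z. j < N \<Longrightarrow> eigenvalue \<Lambda> \<mu> \<Longrightarrow> eigenvalue (cmat A) z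
                   \<Longrightarrow> complex_of_real (\<omega> j) * \<mu> * z \<noteq> 1"
    and jordan_sizes: "0 \<notin> fst ` set blocks"
    and jordan: "similar_mat_wit (jordan_matrix blocks) ((Lambda_hat N s \<omega> \<Lambda> \<beta>)\<^sup>T) S Sinv"
    and obs: "observable ((Lambda_hat N s \<omega> \<Lambda> \<beta>)\<^sup>T) (ones_row (N * s))"
  shows "\<forall>l < length blocks.
    let h0 = cmat B;
        H' = H_hat (cmat A) h0 (Lambda_hat N s \<omega> \<Lambda> \<beta>) * Sinv;
        H'l = col_block H' (map fst blocks) l;
        sl = fst (blocks ! l);
        \<mu>l = snd (blocks ! l)
    in (\<mu>l \<noteq> 0 \<longrightarrow> vec_span n (set (cols H'l)) =
          vec_span n {col ((the (mat_inverse (1\<^sub>m n - \<mu>l \<cdot>\<^sub>m cmat A))) ^\<^sub>m i * h0) 0 | i. i \<in> {1..sl}})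
     \<and> (\<mu>l = 0 \<longrightarrow> vec_span n (set (cols H'l)) =
          vec_span n {col (cmat A ^\<^sub>m i * h0) 0 | i. i \<in> {0..<sl}})"
proof (intro allI impI)
  fix l assume l: "l < length blocks"
  define m where "m = N * s"
  define h0 where "h0 = cmat B"
  define b where "b = col h0 0"
  define L where "L = Lambda_hat N s \<omega> \<Lambda> \<beta>"
  define H' where "H' = H_hat (cmat A) h0 L * Sinv"
  define sl where "sl = fst (blocks ! l)"
  define \<mu> where "\<mu> = snd (blocks ! l)"
  define off where "off = sum_list (take l (map fst blocks))"
  define R where "R = the (mat_inverse (1\<^sub>m n - \<mu> \<cdot>\<^sub>m cmat A))"
  let ?A = "cmat A" and ?J = "jordan_matrix blocks"
  have cA: "?A \<in> carrier_mat n n" using A by simp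
  have h0: "h0 \<in> carrier_mat n 1" using B by (simp add: h0_def)
  have b: "b \<in> carrier_vec n" using h0 by (auto simp: b_def)
  have L: "L \<in> carrier_mat m m" by (simp add: L_def m_def Lambda_hat_def)
  note sim = jordan[folded L_def]
  have m: "m = sum_list (map fst blocks)"
    using carrier_matD[OF similar_mat_witD(5)[OF refl sim]] carrier_matD[OF L] by simp
  have J: "?J \<in> carrier_mat m m" unfolding m by simp
  note w = similar_mat_witD2[OF J sim]
  note M = w(5) and S = w(6) and Q = w(7)
  have sl: "0 < sl" using jordan_sizes l unfolding sl_def
    by (metis gr0I image_eqI nth_mem)
  have idx: "off + j < m" and diag: "?J $$ (off + j, off + j) = \<mu>" if "j < sl" for j
    using jordan_matrix_diag[OF l, of j] that unfolding m off_def \<mu>_def sl_def by auto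
  have off: "off < m" and diag0: "?J $$ (off, off) = \<mu>" using idx[OF sl] diag[OF sl] by simp_all
  have super: "?J $$ (k, Suc k) = (if j = 0 then 0 else 1)" if "j < sl" "Suc k = off + j" for j k
    using jordan_matrix_superdiag[OF l, of j k] that unfolding off_def sl_def by auto
  have bidiag: "?J $$ (i, k) = 0" if "i < m" "k < m" "i \<noteq> k" "Suc i \<noteq> k" for i k
    by (rule jordan_matrix_bidiagonal) (use that m in simp_all)
  have det: "det (1\<^sub>m n - ?J $$ (k, k) \<cdot>\<^sub>m ?A) \<noteq> 0" if k: "k < m" for k
  proof (rule det_one_minus_smult[OF cA])
    fix z assume z: "eigenvalue ?A z"
    have "upper_triangular ?J" by (auto simp: jordan_matrix_upper_triangular)
    from eigenvalue_similar[OF J sim eigenvalue_diag_upper_triangular[OF J this k]]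
    have ev: "eigenvalue ((Lambda_hat N s \<omega> \<Lambda> \<beta>)\<^sup>T) (?J $$ (k, k))" unfolding L_def .
    obtain i \<mu>' where "i < N" "eigenvalue \<Lambda> \<mu>'" "?J $$ (k, k) = complex_of_real (\<omega> i) * \<mu>'"
      by (rule eigenvalue_Lambda_hat[OF Lambda _ ev]) (use omega in force)
    then show "?J $$ (k, k) * z \<noteq> 1" using nonres[OF _ _ z] by simp
  qed
  define K where "K = kronecker (ones_row m) h0"
  have K: "K \<in> carrier_mat n m" unfolding K_def kronecker_ones_row[OF h0] by simp
  have KQ: "K * Sinv \<in> carrier_mat n m" using K Q by auto
  note sol = H_hat_solution[OF cA h0 L sim det, folded H'_def K_def]
  have H': "H' \<in> carrier_mat n m" using sol(1) Q by (auto simp: H'_def)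
  define e where "e k = row (ones_row m) 0 \<bullet> col Sinv k" for k
  have colK: "col (K * Sinv) k = e k \<cdot>\<^sub>v b" if "k < m" for k
    unfolding K_def kronecker_ones_row[OF h0] e_def b_def
    unfolding ones_row_def using that Q h0
    by (intro eq_vecI) (simp_all add: scalar_prod_def sum_distrib_left mult.commute)
  have cols: "col H' k = the (mat_inverse (1\<^sub>m n - ?J $$ (k, k) \<cdot>\<^sub>m ?A)) *\<^sub>v
      (e k \<cdot>\<^sub>v b + ?A *\<^sub>v (if k = 0 then 0\<^sub>v n else ?J $$ (k - 1, k) \<cdot>\<^sub>v col H' (k - 1)))"
    if "k < m" for k
  proof -
    have "\<forall>k<m. col H' k = the (mat_inverse (1\<^sub>m n - ?J $$ (k, k) \<cdot>\<^sub>m ?A)) *\<^sub>v (col (K * Sinv) k +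
      ?A *\<^sub>v (if k = 0 then 0\<^sub>v n else ?J $$ (k - 1, k) \<cdot>\<^sub>v col H' (k - 1)))"
      by (rule iffD1[OF sylvester_columns[OF cA KQ J H'] sol(2)]) (rule bidiag det; assumption)+
    with that show ?thesis unfolding colK[OF that, symmetric] by blast
  qed
  define x where "x j = col H' (off + j)" for j
  have xc: "x j \<in> carrier_vec n" if "j < sl" for j using H' idx[OF that] by (auto simp: x_def)
  have M1: "1\<^sub>m n - \<mu> \<cdot>\<^sub>m ?A \<in> carrier_mat n n" using cA by auto
  have R: "R \<in> carrier_mat n n" "R * (1\<^sub>m n - \<mu> \<cdot>\<^sub>m ?A) = 1\<^sub>m n"
    using mat_inverse_det[OF M1] det[OF off] unfolding R_def diag0 by auto
  \<comment> \<open>The first column of a block: either there is no preceding column, or the superdiagonal entry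
    that would couple to it is zero.\<close>
  have x0: "x 0 = e off \<cdot>\<^sub>v (R *\<^sub>v b)"
  proof -
    have "(if off = 0 then 0\<^sub>v n else ?J $$ (off - 1, off) \<cdot>\<^sub>v col H' (off - 1)) = 0\<^sub>v n"
      using super[OF sl, of "off - 1"] H' off by auto
    moreover have "?A *\<^sub>v 0\<^sub>v n = 0\<^sub>v n" using mult_mat_vec[OF cA, of "0\<^sub>v n" 0] cA by auto
    ultimately show ?thesis
      using cols[OF off] b R unfolding x_def diag0 R_def[symmetric] by (simp add: mult_mat_vec[OF R(1)])
  qed
  have xSuc: "x (Suc j) = e (off + Suc j) \<cdot>\<^sub>v (R *\<^sub>v b) + (R * ?A) *\<^sub>v x j" if j: "Suc j < sl" for j
  proof -
    have "x (Suc j) = R *\<^sub>v (e (off + Suc j) \<cdot>\<^sub>v b + ?A *\<^sub>v x j)"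
      using cols[OF idx[OF j]] diag[OF j] super[OF j, of "off + j"] xc[of j] j
      by (simp add: x_def R_def)
    then show ?thesis using b xc[of j] j R cA
      by (simp add: mult_add_distrib_mat_vec[OF R(1)] mult_mat_vec[OF R(1)])
  qed
  have e0: "e off \<noteq> 0"
  proof -
    \<comment> \<open>\<open>L\<^sup>T Sinv = Sinv J\<close>, and column \<open>off\<close> of \<open>J\<close> is diagonal, so column \<open>off\<close> of \<open>Sinv\<close> is an eigenvector.\<close>
    let ?v = "col Sinv off"
    have v: "?v \<in> carrier_vec m" using Q off by auto
    have "Sinv * ?J = Sinv * (S * (L\<^sup>T * Sinv))" using w(3) assoc_mult_mat[OF S M Q] by simp
    also have "\<dots> = L\<^sup>T * Sinv"
      using assoc_mult_mat[OF Q S, of "L\<^sup>T * Sinv" m] w(2) M Q by simp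
    finally have "L\<^sup>T *\<^sub>v ?v = col (Sinv * ?J) off" using col_mult2[OF M Q off] by simp
    also have "\<dots> = \<mu> \<cdot>\<^sub>v ?v"
      unfolding col_mult_bidiagonal[OF Q J off bidiag[OF _ off], simplified] diag0
      using super[OF sl, of "off - 1"] v Q by auto
    finally have Mv: "L\<^sup>T *\<^sub>v ?v = \<mu> \<cdot>\<^sub>v ?v" .
    have "S *\<^sub>v ?v = unit_vec m off" using col_mult2[OF S Q off] w(1) off by simp
    moreover have "S *\<^sub>v 0\<^sub>v m = 0\<^sub>v m" using mult_mat_vec[OF S, of "0\<^sub>v m" 0] S by auto
    moreover have "unit_vec m off \<noteq> (0\<^sub>v m :: complex vec)"
    proof
      assume "unit_vec m off = (0\<^sub>v m :: complex vec)"
      then have "unit_vec m off $ off = (0\<^sub>v m :: complex vec) $ off" by (rule arg_cong)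
      then show False using off by simp
    qed
    ultimately have "?v \<noteq> 0\<^sub>v m" by auto
    then have "eigenvector (L\<^sup>T) ?v \<mu>" using Mv v M by (auto simp: eigenvector_def)
    with observable_eigenvector[OF M _ obs[folded L_def m_def]] show ?thesis
      unfolding e_def by (auto simp: ones_row_def)
  qed
  have cols_block: "set (cols (col_block H' (map fst blocks) l)) = x ` {..<sl}"
  proof -
    let ?Z = "col_block H' (map fst blocks) l"
    have "set (cols ?Z) = col ?Z ` {..<sl}"
      using l by (simp add: cols_def col_block_def sl_def lessThan_atLeast0)
    also have "\<dots> = x ` {..<sl}"
    proof (rule image_cong[OF refl])
      fix j assume "j \<in> {..<sl}"
      then show "col ?Z j = x j" unfolding x_def off_def
        using idx[of j] l H' by (intro col_col_block) (simp_all add: sl_def off_def)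
    qed
    finally show ?thesis .
  qed
  interpret V: vec_space "TYPE(complex)" n .
  have colpow: "X *\<^sub>v b = col (X * h0) 0" if "X \<in> carrier_mat n n" for X
    unfolding b_def using col_mult2[OF that h0, of 0] by simp
  have nonzero: "V.span (x ` {..<sl}) = V.span {col (R ^\<^sub>m i * h0) 0 | i. i \<in> {1..sl}}"
    if \<mu>0: "\<mu> \<noteq> 0"
  proof -
    have "V.span (x ` {..<sl}) = V.span ((\<lambda>i. R ^\<^sub>m Suc i *\<^sub>v b) ` {..<sl})"
      by (rule V.span_resolvent_chain[OF cA R \<mu>0 b, where e = "\<lambda>j. e (off + j)"])
        (use x0 xSuc e0 in simp_all)
    also have "(\<lambda>i. R ^\<^sub>m Suc i *\<^sub>v b) ` {..<sl} = (\<lambda>i. col (R ^\<^sub>m i * h0) 0) ` Suc ` {..<sl}"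
      unfolding image_image by (rule image_cong[OF refl]) (rule colpow[OF pow_carrier_mat[OF R(1)]])
    also have "\<dots> = {col (R ^\<^sub>m i * h0) 0 | i. i \<in> {1..sl}}"
      by (simp only: image_Suc_lessThan Setcompr_eq_image Collect_mem_eq)
    finally show ?thesis .
  qed
  have zero: "V.span (x ` {..<sl}) = V.span {col (?A ^\<^sub>m i * h0) 0 | i. i \<in> {0..<sl}}"
    if \<mu>0: "\<mu> = 0"
  proof -
    have "1\<^sub>m n - \<mu> \<cdot>\<^sub>m ?A = 1\<^sub>m n" using \<mu>0 cA by (intro eq_matI) auto
    then have "R = 1\<^sub>m n" using R by simp
    then have "V.span (x ` {..<sl}) = V.span ((\<lambda>i. ?A ^\<^sub>m i *\<^sub>v b) ` {..<sl})"
      by (intro V.span_power_chain[OF cA b, where e = "\<lambda>j. e (off + j)"])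
        (use x0 xSuc e0 b left_mult_one_mat[OF cA] in simp_all)
    also have "(\<lambda>i. ?A ^\<^sub>m i *\<^sub>v b) ` {..<sl} = (\<lambda>i. col (?A ^\<^sub>m i * h0) 0) ` {..<sl}"
      by (rule image_cong[OF refl]) (rule colpow[OF pow_carrier_mat[OF cA]])
    also have "\<dots> = {col (?A ^\<^sub>m i * h0) 0 | i. i \<in> {0..<sl}}"
      by (simp only: Setcompr_eq_image Collect_mem_eq lessThan_atLeast0)
    finally show ?thesis .
  qed
  show "let h0 = cmat B;
        H' = H_hat (cmat A) h0 (Lambda_hat N s \<omega> \<Lambda> \<beta>) * Sinv;
        H'l = col_block H' (map fst blocks) l;
        sl = fst (blocks ! l);
        \<mu>l = snd (blocks ! l)
    in (\<mu>l \<noteq> 0 \<longrightarrow> vec_span n (set (cols H'l)) =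
          vec_span n {col ((the (mat_inverse (1\<^sub>m n - \<mu>l \<cdot>\<^sub>m cmat A))) ^\<^sub>m i * h0) 0 | i. i \<in> {1..sl}})
     \<and> (\<mu>l = 0 \<longrightarrow> vec_span n (set (cols H'l)) =
          vec_span n {col (cmat A ^\<^sub>m i * h0) 0 | i. i \<in> {0..<sl}})"
    unfolding Let_def h0_def[symmetric] L_def[symmetric] H'_def[symmetric] sl_def[symmetric]
      \<mu>_def[symmetric] R_def[symmetric] cols_block
    using nonzero zero by simp
qed

end
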